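(* Let $S\subset(0,+\infty)$ be countable. Then the group $\mathrm{Aut}(\mathbf{Q}_S,<^{\mathbf{Q}_S}_{lex})$ of order-preserving isometries of $\mathbf{Q}_S$ onto itself, with the topology of pointwise convergence for the discrete topology on $\mathbf{Q}_S$, is extremely amenable.
   Context: $\mathbf{Q}_S$ is the set of finitely supported functions $x:S\to\mathbb{Q}$ with the ultrametric $d(x,y)=\min\{s\in S:\forall t\in S\,(s<t\Rightarrow x(t)=y(t))\}$ for $x\neq y$, $d(x,x)=0$. The ordering $<^{\mathbf{Q}_S}_{lex}$ is defined for $x\neq y$ by $x<y$ iff $x(d(x,y))<y(d(x,y))$. A topological group $G$ is extremely amenable if every continuous action of $G$ on a nonempty compact Hausdorff space has a fixed point. *)

theory Defs
  imports "HOL-Analysis.Analysis" "HOL-Algebra.Group_Action"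
begin

definition topological_group :: "('g, 'm) monoid_scheme \<Rightarrow> 'g topology \<Rightarrow> bool" where
  "topological_group G T \<longleftrightarrow>
     group G \<and> topspace T = carrier G \<and>
     continuous_map (prod_topology T T) T (\<lambda>(g, h). g \<otimes>\<^bsub>G\<^esub> h) \<and>
     continuous_map T T (\<lambda>g. inv\<^bsub>G\<^esub> g)"

definition continuous_action ::
    "('g, 'm) monoid_scheme \<Rightarrow> 'g topology \<Rightarrow> 'x topology \<Rightarrow> ('g \<Rightarrow> 'x \<Rightarrow> 'x) \<Rightarrow> bool" where
  "continuous_action G T X \<phi> \<longleftrightarrow>
     group_action G (topspace X) \<phi> \<and>
     continuous_map (prod_topology T X) X (\<lambda>(g, x). \<phi> g x)"

text \<open>A HOL formula cannot quantify over all types, so the type carrying the compact spaces is a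
  parameter. A theorem concluding \<open>extremely_amenable TYPE('x) G T\<close> with \<open>'x\<close> a free
  type variable speaks about compact Hausdorff spaces over every type.\<close>

definition extremely_amenable ::
    "'x itself \<Rightarrow> ('g, 'm) monoid_scheme \<Rightarrow> 'g topology \<Rightarrow> bool" where
  "extremely_amenable (_ :: 'x itself) G T \<longleftrightarrow>
     topological_group G T \<and>
     (\<forall>(X :: 'x topology) \<phi>.
        topspace X \<noteq> {} \<and> compact_space X \<and> Hausdorff_space X \<and> continuous_action G T X \<phi> \<longrightarrow>
        (\<exists>x\<in>topspace X. \<forall>g\<in>carrier G. \<phi> g x = x))"

definition QS :: "real set \<Rightarrow> (real \<Rightarrow> rat) set" where
  "QS S = {x \<in> S \<rightarrow>\<^sub>E UNIV. finite {s \<in> S. x s \<noteq> 0}}"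

definition QS_dist :: "real set \<Rightarrow> (real \<Rightarrow> rat) \<Rightarrow> (real \<Rightarrow> rat) \<Rightarrow> real" where
  "QS_dist S x y =
     (if x = y then 0 else (LEAST s. s \<in> S \<and> (\<forall>t\<in>S. s < t \<longrightarrow> x t = y t)))"

text \<open>The minimum in the definition of the distance exists, although \<open>S\<close> need not be
  well-ordered: it is the largest point at which the two functions differ.\<close>

lemma QS_dist_eq_Max:
  assumes "x \<in> QS S" "y \<in> QS S" "x \<noteq> y"
  shows "QS_dist S x y = Max {s \<in> S. x s \<noteq> y s}"
    and "QS_dist S x y \<in> S"
    and "x (QS_dist S x y) \<noteq> y (QS_dist S x y)"
    and "\<And>t. t \<in> S \<Longrightarrow> QS_dist S x y < t \<Longrightarrow> x t = y t"
proof -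
  define D where "D = {s \<in> S. x s \<noteq> y s}"
  have sub: "D \<subseteq> {s \<in> S. x s \<noteq> 0} \<union> {s \<in> S. y s \<noteq> 0}"
    unfolding D_def by auto
  have "finite {s \<in> S. x s \<noteq> 0}" "finite {s \<in> S. y s \<noteq> 0}"
    using assms by (simp_all add: QS_def)
  then have fin: "finite D"
    using finite_subset[OF sub] by simp
  have ext: "x \<in> S \<rightarrow>\<^sub>E UNIV" "y \<in> S \<rightarrow>\<^sub>E UNIV"
    using assms by (simp_all add: QS_def)
  have ne: "D \<noteq> {}"
  proof
    assume "D = {}"
    then have "x s = y s" if "s \<in> S" for s
      using that unfolding D_def by simp
    then have "x = y"
      by (rule PiE_ext[OF ext])
    with assms(3) show False ..
  qed
  define m where "m = Max D"
  have mD: "m \<in> D"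
    unfolding m_def by (rule Max_in[OF fin ne])
  then have mS: "m \<in> S" and md: "x m \<noteq> y m"
    by (simp_all add: D_def)
  have above: "x t = y t" if "t \<in> S" "m < t" for t
  proof (rule ccontr)
    assume "x t \<noteq> y t"
    with that(1) have "t \<in> D"
      by (simp add: D_def)
    then have "t \<le> m"
      unfolding m_def by (rule Max_ge[OF fin])
    with that(2) show False by simp
  qed
  have "(LEAST s. s \<in> S \<and> (\<forall>t\<in>S. s < t \<longrightarrow> x t = y t)) = m"
  proof (rule Least_equality)
    show "m \<in> S \<and> (\<forall>t\<in>S. m < t \<longrightarrow> x t = y t)"
      using mS above by simp
  next
    fix s assume s: "s \<in> S \<and> (\<forall>t\<in>S. s < t \<longrightarrow> x t = y t)"
    show "m \<le> s"
    proof (rule ccontr)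
      assume "\<not> m \<le> s"
      then have "s < m" by simp
      with s mS md show False by simp
    qed
  qed
  with assms(3) have eq: "QS_dist S x y = m"
    by (simp add: QS_dist_def)
  show "QS_dist S x y = Max {s \<in> S. x s \<noteq> y s}"
    by (simp only: eq m_def D_def)
  show "QS_dist S x y \<in> S" "x (QS_dist S x y) \<noteq> y (QS_dist S x y)"
    using mS md by (simp_all only: eq not_False_eq_True)
  show "\<And>t. t \<in> S \<Longrightarrow> QS_dist S x y < t \<Longrightarrow> x t = y t"
    using above by (simp only: eq)
qed

definition QS_lex :: "real set \<Rightarrow> (real \<Rightarrow> rat) \<Rightarrow> (real \<Rightarrow> rat) \<Rightarrow> bool" where
  "QS_lex S x y \<longleftrightarrow> x \<noteq> y \<and> x (QS_dist S x y) < y (QS_dist S x y)"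

definition Aut_QS_lex :: "real set \<Rightarrow> ((real \<Rightarrow> rat) \<Rightarrow> (real \<Rightarrow> rat)) monoid" where
  "Aut_QS_lex S = BijGroup (QS S)
     \<lparr>carrier := {f \<in> Bij (QS S). \<forall>x\<in>QS S. \<forall>y\<in>QS S.
        QS_dist S (f x) (f y) = QS_dist S x y \<and> (QS_lex S (f x) (f y) \<longleftrightarrow> QS_lex S x y)}\<rparr>"

definition pointwise_topology ::
    "real set \<Rightarrow> ((real \<Rightarrow> rat) \<Rightarrow> (real \<Rightarrow> rat)) topology" where
  "pointwise_topology S =
     subtopology (product_topology (\<lambda>_. discrete_topology (QS S)) (QS S)) (carrier (Aut_QS_lex S))"

end

theory Submission
  imports Defs "HOL-Library.Ramsey"
begin

text \<open>An automorphism \<open>f\<close> acts at each level \<open>s \<in> S\<close>, above each prefix \<open>u\<close> (the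
  coordinates above \<open>s\<close>), by an order automorphism of the rationals. The automorphisms acting
  nontrivially only at level \<open>s\<close> above the prefix of \<open>a\<close> form a copy \<open>K s a\<close> of
  \<open>Aut(\<rat>, <)\<close>, which is extremely amenable by Ramsey's theorem (Pestov).

  Elements that change no coordinate below \<open>s\<close> permute the groups \<open>K s b\<close> by conjugation, and
  \<open>K s a\<close> normalises each \<open>K s b\<close>. Hence the common fixed points of finitely many low levels form
  a closed set invariant under all higher ones, so fixed points can be found one level at a time from
  the bottom up, and compactness yields a common fixed point of all \<open>K s a\<close>. These groups generate
  a dense subgroup, since correcting finitely many pairs (level, prefix) from the top down reproduces
  any automorphism on a finite set. So the fixed point is fixed by the whole group.\<close>

unbundle no m_inv_syntax

section \<open>Order automorphisms of the rationals\<close>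

definition rat_aut :: "(rat \<Rightarrow> rat) set" where
  "rat_aut = {p. bij p \<and> strict_mono p}"

lemma rat_autI: "strict_mono p \<Longrightarrow> surj p \<Longrightarrow> p \<in> rat_aut"
  by (simp add: rat_aut_def bij_def strict_mono_imp_inj_on)

lemma id_rat_aut: "id \<in> rat_aut"
  by (simp add: rat_aut_def strict_mono_def)

lemma comp_rat_aut: "p \<in> rat_aut \<Longrightarrow> q \<in> rat_aut \<Longrightarrow> p \<circ> q \<in> rat_aut"
  by (auto simp: rat_aut_def bij_comp strict_mono_def)

lemma inv_rat_aut:
  assumes "p \<in> rat_aut"
  shows "inv p \<in> rat_aut" and "p \<circ> inv p = id" and "inv p \<circ> p = id"
proof -
  have p: "bij p" "strict_mono p"
    using assms by (auto simp: rat_aut_def)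
  show *: "p \<circ> inv p = id" "inv p \<circ> p = id"
    using p(1) by (auto simp: bij_def surj_iff inj_iff)
  have "strict_mono (inv p)"
    using strict_mono_less[OF p(2)] bij_is_surj[OF p(1)]
    by (metis strict_monoI surj_f_inv_f)
  then show "inv p \<in> rat_aut"
    by (simp add: rat_aut_def bij_imp_bij_inv[OF p(1)])
qed

text \<open>A piecewise affine map works: the identity up to \<open>m\<close>, then slope
  \<open>(c - m) / (b - m)\<close>. It moves one point while leaving everything up to
  \<open>m\<close> in place.\<close>

lemma rat_aut_extend_above:
  fixes m b c :: rat
  assumes "m < b" "m < c"
  obtains h where "h \<in> rat_aut" "h b = c" "\<And>x. x \<le> m \<Longrightarrow> h x = x"
proof -
  define k where "k = (c - m) / (b - m)"
  have k: "k > 0"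
    using assms by (simp add: k_def)
  define h where "h x = (if x \<le> m then x else m + (x - m) * k)" for x
  have above: "m < m + (x - m) * k" if "m < x" for x
    using that k by simp
  have "strict_mono h"
  proof (rule strict_monoI)
    fix x y :: rat assume "x < y"
    then show "h x < h y"
      using k le_less_trans[OF _ above[of y], of x] by (cases "y \<le> m") (auto simp: h_def)
  qed
  moreover have "surj h"
  proof (rule surjI)
    fix y
    show "h (if y \<le> m then y else m + (y - m) / k) = y"
      using k by (auto simp: h_def not_le divide_le_0_iff)
  qed
  moreover have "h b = c"
    using assms by (simp add: h_def k_def)
  ultimately show thesis
    using that[of h] by (simp add: rat_autI h_def)
qed

text \<open>Finite homogeneity of the rationals. The points of \<open>B\<close> are placed in
  increasing order; a map placing the smaller ones is corrected above their images so that the new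
  maximum reaches the maximum of \<open>C\<close>.\<close>

lemma rat_aut_image:
  assumes "finite B" "finite C" "card B = card C"
  shows "\<exists>p\<in>rat_aut. p ` B = C"
  using assms
proof (induction B arbitrary: C rule: finite_linorder_max_induct)
  case empty
  then show ?case
    using id_rat_aut by auto
next
  case (insert b B)
  define c where "c = Max C"
  have "b \<notin> B"
    using insert.hyps(2) by blast
  then have card: "card C = Suc (card B)"
    using insert.prems insert.hyps(1) by simp
  then have "C \<noteq> {}"
    by auto
  then have c: "c \<in> C" "\<And>x. x \<in> C \<Longrightarrow> x \<le> c"
    using insert.prems(1) by (auto simp: c_def)
  obtain p where p: "p \<in> rat_aut" "p ` B = C - {c}"
    using insert.IH[of "C - {c}"] insert.prems(1) card c(1) by auto
  show ?case
  proof (cases "B = {}")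
    case True
    have C: "C = {c}"
      using p(2) c(1) True by auto
    have "(\<lambda>x. x + (c - b)) \<in> rat_aut"
    proof (rule rat_autI)
      show "surj (\<lambda>x. x + (c - b))"
        by (rule surjI[of _ "\<lambda>y. y - (c - b)"]) simp
    qed (simp add: strict_mono_def)
    then show ?thesis
      using True by (intro bexI[of _ "\<lambda>x. x + (c - b)"]) (simp_all add: C)
  next
    case False
    \<comment> \<open>Both \<open>p b\<close> and \<open>c\<close> exceed every point of
      \<open>C - {c}\<close>, so the correction can fix that set pointwise.\<close>
    define m where "m = Max (C - {c})"
    have fin: "finite (C - {c})" "C - {c} \<noteq> {}"
      using insert.prems(1) False p(2) by auto
    then have "m \<in> p ` B"
      using Max_in[OF fin] by (simp add: m_def p(2))
    then have "m < p b"
      using insert.hyps(2) p(1) by (auto simp: rat_aut_def strict_mono_less)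
    moreover have "m < c"
      using Max_in[OF fin] c(2) by (fastforce simp: m_def)
    ultimately obtain h where h: "h \<in> rat_aut" "h (p b) = c" "\<And>x. x \<le> m \<Longrightarrow> h x = x"
      using rat_aut_extend_above by blast
    have "h ` p ` B = C - {c}"
      using h(3) Max_ge[OF fin(1)] unfolding p(2) m_def by simp
    then have "(h \<circ> p) ` insert b B = C"
      using h(2) c(1) by (auto simp flip: image_image)
    then show ?thesis
      using comp_rat_aut[OF h(1) p(1)] by blast
  qed
qed

text \<open>A finite chain is rigid: the maximum goes to the maximum, and removing it leaves a
  smaller instance. So the image of a finite set determines an order automorphism on that
  set.\<close>

lemma strict_mono_eq_on_finite:
  fixes p q :: "rat \<Rightarrow> rat"
  assumes "strict_mono p" "strict_mono q" "finite F" "p ` F = q ` F" "r \<in> F"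
  shows "p r = q r"
  using assms(3-5)
proof (induction F rule: finite_linorder_max_induct)
  case empty
  then show ?case
    by simp
next
  case (insert b B)
  have M: "Max (f ` insert b B) = f b" if "strict_mono f" for f :: "rat \<Rightarrow> rat"
    using insert.hyps by (intro Max_eqI) (auto simp: strict_mono_less_eq[OF that])
  have b: "p b = q b"
    using M[OF assms(1)] M[OF assms(2)] insert.prems(1) by simp
  have D: "f ` insert b B - {f b} = f ` B" if "strict_mono f" for f :: "rat \<Rightarrow> rat"
    using insert.hyps that by (fastforce simp: strict_mono_eq)
  have "p ` B = q ` B"
    using D[OF assms(1)] D[OF assms(2)] insert.prems(1) b by metis
  then show ?case
    using insert.IH insert.prems(2) b by auto
qed

text \<open>If nothing is fixed, finitely many open sets, each disjoint from its image under some
  \<open>P d\<close>, cover \<open>X\<close>. Colouring \<open>g ` E\<close> by a set containing \<open>\<rho> (inv g) x0\<close> and passing to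
  a homogeneous set puts both \<open>\<rho> (inv h) x0\<close> and its image under \<open>P d\<close> into the same one.\<close>

proposition rat_aut_fixed_point:
  fixes X :: "'x topology" and \<rho> :: "(rat \<Rightarrow> rat) \<Rightarrow> 'x \<Rightarrow> 'x"
  assumes ne: "topspace X \<noteq> {}" and comp: "compact_space X" and haus: "Hausdorff_space X"
    and closed: "\<And>p x. p \<in> rat_aut \<Longrightarrow> x \<in> topspace X \<Longrightarrow> \<rho> p x \<in> topspace X"
    and id: "\<And>x. x \<in> topspace X \<Longrightarrow> \<rho> id x = x"
    and mult: "\<And>p q x. p \<in> rat_aut \<Longrightarrow> q \<in> rat_aut \<Longrightarrow> x \<in> topspace X \<Longrightarrow>
       \<rho> (p \<circ> q) x = \<rho> p (\<rho> q x)"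
    and cont: "\<And>p x U. p \<in> rat_aut \<Longrightarrow> x \<in> topspace X \<Longrightarrow> openin X U \<Longrightarrow> \<rho> p x \<in> U \<Longrightarrow>
       \<exists>F W. finite F \<and> openin X W \<and> x \<in> W \<and>
         (\<forall>q\<in>rat_aut. (\<forall>r\<in>F. q r = p r) \<longrightarrow> (\<forall>y\<in>W. \<rho> q y \<in> U))"
  shows "\<exists>x\<in>topspace X. \<forall>p\<in>rat_aut. \<rho> p x = x"
proof (rule ccontr)
  assume "\<not> ?thesis"
  then have moved: "\<exists>p\<in>rat_aut. \<rho> p x \<noteq> x" if "x \<in> topspace X" for x
    using that by blast
  \<comment> \<open>Maps fixing \<open>F\<close> pointwise carry \<open>W\<close> into
    \<open>U\<close>. This margin later absorbs the choice of a representative with prescribed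
    values on a finite set.\<close>
  have "\<exists>p F W U. p \<in> rat_aut \<and> finite F \<and> openin X W \<and> x \<in> W \<and> (\<forall>y\<in>U. \<rho> p y \<notin> U) \<and>
      (\<forall>q\<in>rat_aut. (\<forall>r\<in>F. q r = r) \<longrightarrow> (\<forall>y\<in>W. \<rho> q y \<in> U))" if x: "x \<in> topspace X" for x
  proof -
    obtain p where p: "p \<in> rat_aut" "\<rho> p x \<noteq> x"
      using moved[OF x] by blast
    then obtain O1 O2 where O: "openin X O1" "openin X O2" "x \<in> O1" "\<rho> p x \<in> O2" "disjnt O1 O2"
      using haus closed[OF p(1) x] x unfolding Hausdorff_space_def by metis
    obtain W1 where W1: "openin X W1" "x \<in> W1" "\<forall>y\<in>W1. \<rho> p y \<in> O2"
      using cont[OF p(1) x O(2,4)] p(1) by blast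
    obtain F W where "finite F" "openin X W" "x \<in> W"
      "\<forall>q\<in>rat_aut. (\<forall>r\<in>F. q r = r) \<longrightarrow> (\<forall>y\<in>W. \<rho> q y \<in> O1 \<inter> W1)"
      using cont[OF id_rat_aut x, of "O1 \<inter> W1"] O(1,3) W1(1,2) by (auto simp: id[OF x])
    moreover have "\<forall>y\<in>O1 \<inter> W1. \<rho> p y \<notin> O1 \<inter> W1"
      using W1(3) O(5) by (auto simp: disjnt_iff)
    ultimately show ?thesis
      using p(1) by blast
  qed
  then obtain P F W U where PFWU: "\<And>x. x \<in> topspace X \<Longrightarrow> P x \<in> rat_aut \<and> finite (F x) \<and>
      openin X (W x) \<and> x \<in> W x \<and> (\<forall>y\<in>U x. \<rho> (P x) y \<notin> U x) \<and>
      (\<forall>q\<in>rat_aut. (\<forall>r\<in>F x. q r = r) \<longrightarrow> (\<forall>y\<in>W x. \<rho> q y \<in> U x))"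
    by metis
  obtain D where D: "finite D" "D \<subseteq> topspace X" "topspace X \<subseteq> (\<Union>x\<in>D. W x)"
  proof -
    have "\<forall>O'\<in>W ` topspace X. openin X O'" and "topspace X \<subseteq> \<Union> (W ` topspace X)"
      using PFWU by blast+
    then obtain \<F> where "finite \<F>" "\<F> \<subseteq> W ` topspace X" "topspace X \<subseteq> \<Union>\<F>"
      using comp unfolding compact_space_alt by meson
    then show thesis
      using that by (metis finite_subset_image)
  qed
  obtain x0 where x0: "x0 \<in> topspace X"
    using ne by blast
  define E where "E = (\<Union>x\<in>D. F x)"
  have E: "finite E"
    using D PFWU by (auto simp: E_def)
  \<comment> \<open>By rigidity, any \<open>h\<close> in \<open>rat_aut\<close> sending
    \<open>E\<close> onto \<open>A\<close> agrees with \<open>g A\<close> on \<open>E\<close>, so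
    the arbitrary choice matters only up to a map fixing \<open>E\<close> pointwise.\<close>
  define g where "g A = (SOME p. p \<in> rat_aut \<and> p ` E = A)" for A
  have g: "g A \<in> rat_aut" "g A ` E = A" if "finite A" "card A = card E" for A
    using someI_ex[of "\<lambda>p. p \<in> rat_aut \<and> p ` E = A"] rat_aut_image[OF E that(1)] that(2)
    by (auto simp: g_def)
  define c where "c A = (SOME d. d \<in> D \<and> \<rho> (inv (g A)) x0 \<in> W d)" for A
  have c: "c A \<in> D" "\<rho> (inv (g A)) x0 \<in> W (c A)" if "finite A" "card A = card E" for A
  proof -
    have "\<exists>d. d \<in> D \<and> \<rho> (inv (g A)) x0 \<in> W d"
      using D(3) closed[OF inv_rat_aut(1)[OF g(1)[OF that]] x0] by blast
    then show "c A \<in> D" "\<rho> (inv (g A)) x0 \<in> W (c A)"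
      unfolding c_def by (metis (mono_tags, lifting) someI_ex)+
  qed
  \<comment> \<open>Ramsey's theorem takes natural numbers as colours, so \<open>e\<close> numbers
    the finite cover.\<close>
  obtain e where e: "bij_betw e D {0..<card D}"
    using ex_bij_betw_finite_nat[OF D(1)] by blast
  have "\<exists>Y t. Y \<subseteq> (UNIV :: rat set) \<and> infinite Y \<and> t < card D \<and>
      (\<forall>A. A \<subseteq> Y \<and> finite A \<and> card A = card E \<longrightarrow> (e \<circ> c) A = t)"
    using c(1) e by (intro Ramsey) (auto simp: bij_betw_def infinite_UNIV_char_0)
  then obtain Y t where Y: "infinite Y" "t < card D"
    "\<And>A. A \<subseteq> Y \<Longrightarrow> finite A \<Longrightarrow> card A = card E \<Longrightarrow> e (c A) = t"
    by auto
  obtain d where d: "d \<in> D" "e d = t"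
    using Y(2) bij_betw_imp_surj_on[OF e] by (metis atLeast0LessThan imageE lessThan_iff)
  have cY: "c A = d" if "A \<subseteq> Y" "finite A" "card A = card E" for A
    using Y(3)[OF that] c(1)[OF that(2,3)] d e by (auto simp: bij_betw_def inj_on_def)
  have dX: "d \<in> topspace X"
    using d(1) D(2) by blast
  \<comment> \<open>Write \<open>inv h\<close> as
    \<open>(inv h \<circ> g A) \<circ> inv (g A)\<close>: the right factor sends \<open>x0\<close>
    into \<open>W d\<close>, and the left one fixes \<open>E\<close> pointwise, hence carries
    \<open>W d\<close> into \<open>U d\<close>.\<close>
  have key: "\<rho> (inv h) x0 \<in> U d" if h: "h \<in> rat_aut" "h ` E \<subseteq> Y" for h
  proof -
    define A where "A = h ` E"
    have "inj h"
      using h(1) by (simp add: rat_aut_def bij_def)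
    then have A: "finite A" "card A = card E" "A \<subseteq> Y"
      using E h(2) by (simp_all add: A_def card_image inj_on_subset)
    let ?q = "inv h \<circ> g A"
    have gA: "g A \<in> rat_aut" "g A ` E = h ` E"
      using g[OF A(1,2)] by (simp_all add: A_def)
    have eq: "g A r = h r" if "r \<in> E" for r
      using strict_mono_eq_on_finite[of "g A" h E r] h(1) E that gA by (simp add: rat_aut_def)
    have "?q r = r" if "r \<in> F d" for r
    proof -
      have "r \<in> E"
        using that d(1) by (auto simp: E_def)
      then show ?thesis
        using eq \<open>inj h\<close> by simp
    qed
    moreover have q: "?q \<in> rat_aut"
      by (simp add: comp_rat_aut inv_rat_aut(1) h(1) gA(1))
    moreover have "\<rho> (inv (g A)) x0 \<in> W d"
      using c(2)[OF A(1,2)] cY[OF A(3,1,2)] by simp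
    ultimately have "\<rho> ?q (\<rho> (inv (g A)) x0) \<in> U d"
      using PFWU[OF dX] by blast
    moreover have "?q \<circ> inv (g A) = inv h"
      using inv_rat_aut(2)[OF gA(1)] by (simp add: comp_assoc)
    ultimately show ?thesis
      using mult[OF q inv_rat_aut(1)[OF gA(1)] x0] by simp
  qed
  define p where "p = P d"
  have p: "p \<in> rat_aut"
    using PFWU[OF dX] by (simp add: p_def)
  note ip = inv_rat_aut[OF p]
  \<comment> \<open>A single \<open>h\<close> is to send both \<open>E\<close> and its preimage
    under \<open>p\<close> into \<open>Y\<close>, so that \<open>key\<close> applies to
    \<open>h\<close> and to \<open>h \<circ> inv p\<close>. The two resulting points of
    \<open>U d\<close> differ by the action of \<open>p\<close>, which is impossible.\<close>
  obtain C where C: "C \<subseteq> Y" "finite C" "card C = card (E \<union> inv p ` E)"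
    using infinite_arbitrarily_large[OF Y(1)] by metis
  then obtain h where h: "h \<in> rat_aut" "h ` (E \<union> inv p ` E) = C"
    using rat_aut_image[of "E \<union> inv p ` E" C] E by auto
  have "\<rho> (inv h) x0 \<in> U d"
    using key[OF h(1)] h(2) C(1) by blast
  moreover have "\<rho> (inv (h \<circ> inv p)) x0 \<in> U d"
    using key[OF comp_rat_aut[OF h(1) ip(1)]] h(2) C(1) by (metis Un_upper2 image_comp image_mono order_trans)
  moreover have "inv (h \<circ> inv p) = p \<circ> inv h"
    using h(1) ip(1) p by (simp add: rat_aut_def o_inv_distrib inv_inv_eq)
  ultimately show False
    using PFWU[OF dX] mult[OF p inv_rat_aut(1)[OF h(1)] x0] by (auto simp: p_def)
qed

section \<open>Automorphisms acting on a single level\<close>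

text \<open>For positive \<open>s\<close> in \<open>S\<close> and points of \<open>QS S\<close>,
  this is the relation of being at distance at most \<open>s\<close>; its classes are closed balls.
  The coordinate form treats equal points uniformly.\<close>

definition agree_above :: "real set \<Rightarrow> real \<Rightarrow> (real \<Rightarrow> rat) \<Rightarrow> (real \<Rightarrow> rat) \<Rightarrow> bool" where
  "agree_above S s x y \<longleftrightarrow> (\<forall>t\<in>S. s < t \<longrightarrow> x t = y t)"

lemma agree_above_refl: "agree_above S s x x"
  by (simp add: agree_above_def)

lemma agree_above_sym: "agree_above S s x y \<Longrightarrow> agree_above S s y x"
  by (simp add: agree_above_def)

lemma agree_above_trans: "agree_above S s x y \<Longrightarrow> agree_above S s y z \<Longrightarrow> agree_above S s x z"
  by (simp add: agree_above_def)

lemma agree_above_upd [simp]: "agree_above S s (x(s := q)) y \<longleftrightarrow> agree_above S s x y"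
  by (auto simp: agree_above_def)

lemma QS_eqI: "x \<in> QS S \<Longrightarrow> y \<in> QS S \<Longrightarrow> (\<And>t. t \<in> S \<Longrightarrow> x t = y t) \<Longrightarrow> x = y"
  by (auto simp: QS_def intro: PiE_ext)

lemma QS_upd:
  assumes "x \<in> QS S" "s \<in> S"
  shows "x(s := q) \<in> QS S"
proof -
  have "{t \<in> S. (x(s := q)) t \<noteq> 0} \<subseteq> insert s {t \<in> S. x t \<noteq> 0}"
    by auto
  moreover have "finite {t \<in> S. x t \<noteq> 0}"
    using assms(1) by (simp add: QS_def)
  ultimately have "finite {t \<in> S. (x(s := q)) t \<noteq> 0}"
    by (meson finite_insert finite_subset)
  then show ?thesis
    using assms by (auto simp: QS_def PiE_def extensional_def)
qed

lemma QS_top_difference: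
  assumes "x \<in> QS S" "y \<in> QS S" "x \<noteq> y"
  shows "\<exists>s\<in>S. agree_above S s x y \<and> x s \<noteq> y s"
  using QS_dist_eq_Max(2-4)[OF assms] by (auto simp: agree_above_def)

lemma QS_dist_eqI:
  assumes "x \<in> QS S" "y \<in> QS S" "s \<in> S" "agree_above S s x y" "x s \<noteq> y s"
  shows "QS_dist S x y = s"
proof -
  have "x \<noteq> y"
    using assms(5) by auto
  note d = QS_dist_eq_Max(2-4)[OF assms(1,2) this]
  have "\<not> QS_dist S x y < s"
    using d(3)[OF assms(3)] assms(5) by blast
  moreover have "\<not> s < QS_dist S x y"
    using assms(4) d(1,2) by (auto simp: agree_above_def)
  ultimately show ?thesis
    by simp
qed

text \<open>For distinct points, agreement above \<open>s\<close> bounds the distance by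
  \<open>s\<close>, and an isometry keeps that bound. If the distance is exactly \<open>s\<close>,
  then \<open>QS_lex\<close> compares the coordinates at \<open>s\<close>; if it is smaller, these
  coincide before and after. Conversely, take \<open>s\<close> to be the distance itself.\<close>

lemma carrier_Aut_QS_lex_iff:
  "f \<in> carrier (Aut_QS_lex S) \<longleftrightarrow> f \<in> Bij (QS S) \<and>
     (\<forall>x\<in>QS S. \<forall>y\<in>QS S. \<forall>s\<in>S. agree_above S s x y \<longrightarrow>
        agree_above S s (f x) (f y) \<and> (x s < y s \<longleftrightarrow> f x s < f y s))"
  (is "_ \<longleftrightarrow> _ \<and> ?R")
proof -
  have "f \<in> carrier (Aut_QS_lex S) \<longleftrightarrow> ?R" if f: "f \<in> Bij (QS S)"
  proof -
    have mem: "f x \<in> QS S" if "x \<in> QS S" for x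
      using Bij_imp_funcset[OF f] that by blast
    have inj: "f x \<noteq> f y" if "x \<in> QS S" "y \<in> QS S" "x \<noteq> y" for x y
      using f that by (auto simp: Bij_def bij_betw_def inj_on_def)
    show ?thesis
    proof
      assume "f \<in> carrier (Aut_QS_lex S)"
      then have iso: "QS_dist S (f x) (f y) = QS_dist S x y"
        and lex: "QS_lex S (f x) (f y) \<longleftrightarrow> QS_lex S x y" if "x \<in> QS S" "y \<in> QS S" for x y
        using that by (auto simp: Aut_QS_lex_def)
      show ?R
      proof (intro ballI impI)
        fix x y s assume xy: "x \<in> QS S" "y \<in> QS S" and s: "s \<in> S" "agree_above S s x y"
        show "agree_above S s (f x) (f y) \<and> (x s < y s \<longleftrightarrow> f x s < f y s)"
        proof (cases "x = y")
          case False
          note d = QS_dist_eq_Max(2-4)[OF xy False]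
          have n: "f x \<noteq> f y"
            using inj[OF xy False] .
          note d' = QS_dist_eq_Max(2-4)[OF mem[OF xy(1)] mem[OF xy(2)] n]
          have le: "QS_dist S x y \<le> s"
            using s(2) d(1,2) by (auto simp: agree_above_def not_less[symmetric])
          have *: "agree_above S s (f x) (f y)"
            unfolding agree_above_def
          proof (intro ballI impI)
            fix t assume "t \<in> S" "s < t"
            then show "f x t = f y t"
              using d'(3)[of t] le iso[OF xy] by simp
          qed
          show ?thesis
          proof (cases "QS_dist S x y = s")
            case True
            then show ?thesis
              using * lex[OF xy] iso[OF xy] False n by (auto simp: QS_lex_def)
          next
            case False
            then have "x s = y s" "f x s = f y s"
              using le d(3)[OF s(1)] d'(3)[OF s(1)] iso[OF xy] by simp_all
            then show ?thesis
              using * by simp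
          qed
        qed (simp add: agree_above_refl)
      qed
    next
      assume R: ?R
      have "QS_dist S (f x) (f y) = QS_dist S x y \<and> (QS_lex S (f x) (f y) \<longleftrightarrow> QS_lex S x y)"
        if xy: "x \<in> QS S" "y \<in> QS S" for x y
      proof (cases "x = y")
        case False
        define s where "s = QS_dist S x y"
        have s: "s \<in> S" "x s \<noteq> y s" "agree_above S s x y"
          using QS_dist_eq_Max(2-4)[OF xy False] by (simp_all add: s_def agree_above_def)
        \<comment> \<open>Applying the condition to \<open>(x, y)\<close> and to
          \<open>(y, x)\<close> shows that the images still differ at \<open>s\<close>, so their
          topmost difference is again at \<open>s\<close>.\<close>
        have ag: "agree_above S s (f x) (f y)" and "x s < y s \<longleftrightarrow> f x s < f y s"
          "y s < x s \<longleftrightarrow> f y s < f x s"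
          using R xy s agree_above_sym[OF s(3)] by blast+
        moreover from this have "QS_dist S (f x) (f y) = s"
          using s by (intro QS_dist_eqI mem xy) auto
        ultimately show ?thesis
          using False inj[OF xy False] by (simp add: QS_lex_def flip: s_def)
      qed (simp add: QS_dist_def QS_lex_def)
      then show "f \<in> carrier (Aut_QS_lex S)"
        using f by (simp add: Aut_QS_lex_def)
    qed
  qed
  then show ?thesis
    by (auto simp: Aut_QS_lex_def)
qed

text \<open>Order preservation for both orderings of the pair controls equality at \<open>s\<close>.
  To reflect agreement above \<open>s\<close>, consider the topmost difference of \<open>x\<close>
  and \<open>y\<close>: it survives under \<open>f\<close>, so it cannot lie above
  \<open>s\<close>.\<close>

lemma
  assumes "f \<in> carrier (Aut_QS_lex S)" "x \<in> QS S" "y \<in> QS S" "s \<in> S"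
  shows Aut_QS_agree_above_iff: "agree_above S s (f x) (f y) \<longleftrightarrow> agree_above S s x y"
    and Aut_QS_less_iff: "agree_above S s x y \<Longrightarrow> f x s < f y s \<longleftrightarrow> x s < y s"
    and Aut_QS_eq_iff: "agree_above S s x y \<Longrightarrow> f x s = f y s \<longleftrightarrow> x s = y s"
proof -
  have f: "agree_above S t (f u) (f v) \<and> (u t < v t \<longleftrightarrow> f u t < f v t)"
    if "agree_above S t u v" "u \<in> QS S" "v \<in> QS S" "t \<in> S" for t u v
    using assms(1) that by (simp add: carrier_Aut_QS_lex_iff)
  show less: "f x s < f y s \<longleftrightarrow> x s < y s" if "agree_above S s x y"
    using f that assms(2-4) by blast
  show "f x s = f y s \<longleftrightarrow> x s = y s" if "agree_above S s x y"
    using f[OF that assms(2-4)] f[OF agree_above_sym[OF that] assms(3,2,4)]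
    by (metis linorder_neq_iff)
  show "agree_above S s (f x) (f y) \<longleftrightarrow> agree_above S s x y"
  proof
    assume *: "agree_above S s (f x) (f y)"
    show "agree_above S s x y"
    proof (cases "x = y")
      case False
      obtain t where t: "t \<in> S" "agree_above S t x y" "x t \<noteq> y t"
        using QS_top_difference[OF assms(2,3) False] by blast
      then have "f x t \<noteq> f y t"
        using f[OF t(2) assms(2,3) t(1)] f[OF agree_above_sym[OF t(2)] assms(3,2) t(1)]
        by (metis linorder_neq_iff)
      then have "t \<le> s"
        using * t(1) by (auto simp: agree_above_def not_less[symmetric])
      then show ?thesis
        using t(2) by (simp add: agree_above_def)
    qed (simp add: agree_above_refl)
  qed (use f assms(2-4) in blast)
qed

section \<open>The automorphism group\<close>

lemma subgroup_Aut_QS_lex: "subgroup (carrier (Aut_QS_lex S)) (BijGroup (QS S))"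
proof -
  interpret B: group "BijGroup (QS S)"
    by (rule group_BijGroup)
  have car: "carrier (BijGroup (QS S)) = Bij (QS S)"
    by (simp add: BijGroup_def)
  show ?thesis
  proof (rule B.subgroupI)
    show "carrier (Aut_QS_lex S) \<subseteq> carrier (BijGroup (QS S))"
      by (auto simp: car carrier_Aut_QS_lex_iff)
    have "(\<lambda>x\<in>QS S. x) \<in> carrier (Aut_QS_lex S)"
      by (simp add: carrier_Aut_QS_lex_iff id_Bij)
    then show "carrier (Aut_QS_lex S) \<noteq> {}"
      by blast
  next
    fix f assume f: "f \<in> carrier (Aut_QS_lex S)"
    then have fB: "f \<in> Bij (QS S)"
      by (simp add: carrier_Aut_QS_lex_iff)
    have im: "f ` QS S = QS S"
      using fB by (simp add: Bij_def bij_betw_def)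
    let ?g = "inv_into (QS S) f"
    have g: "?g x \<in> QS S" "f (?g x) = x" if "x \<in> QS S" for x
      using that im inv_into_into[of x f "QS S"] f_inv_into_f[of x f "QS S"] by simp_all
    have "(\<lambda>x\<in>QS S. ?g x) \<in> carrier (Aut_QS_lex S)"
      unfolding carrier_Aut_QS_lex_iff
    proof (intro conjI ballI impI restrict_inv_into_Bij fB)
      fix x y s assume xy: "x \<in> QS S" "y \<in> QS S" and s: "s \<in> S" "agree_above S s x y"
      then have *: "agree_above S s (?g x) (?g y)"
        using Aut_QS_agree_above_iff[OF f g(1)[OF xy(1)] g(1)[OF xy(2)] s(1)] g(2) by simp
      then show "agree_above S s ((\<lambda>x\<in>QS S. ?g x) x) ((\<lambda>x\<in>QS S. ?g x) y)"
        using xy by simp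
      show "x s < y s \<longleftrightarrow> (\<lambda>x\<in>QS S. ?g x) x s < (\<lambda>x\<in>QS S. ?g x) y s"
        using Aut_QS_less_iff[OF f g(1)[OF xy(1)] g(1)[OF xy(2)] s(1) *] g(2) xy by simp
    qed
    then show "m_inv (BijGroup (QS S)) f \<in> carrier (Aut_QS_lex S)"
      by (simp add: inv_BijGroup[OF fB])
  next
    fix f g assume fg: "f \<in> carrier (Aut_QS_lex S)" "g \<in> carrier (Aut_QS_lex S)"
    then have B: "f \<in> Bij (QS S)" "g \<in> Bij (QS S)"
      by (simp_all add: carrier_Aut_QS_lex_iff)
    have mem: "g x \<in> QS S" if "x \<in> QS S" for x
      using Bij_imp_funcset[OF B(2)] that by blast
    have "compose (QS S) f g \<in> carrier (Aut_QS_lex S)"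
      unfolding carrier_Aut_QS_lex_iff
      using fg B mem
      by (auto simp: compose_Bij compose_eq Aut_QS_agree_above_iff Aut_QS_less_iff)
    then show "f \<otimes>\<^bsub>BijGroup (QS S)\<^esub> g \<in> carrier (Aut_QS_lex S)"
      using B by (simp add: BijGroup_def)
  qed
qed

lemma group_Aut_QS_lex: "group (Aut_QS_lex S)"
proof -
  have "BijGroup (QS S)\<lparr>carrier := carrier (Aut_QS_lex S)\<rparr> = Aut_QS_lex S"
    by (simp add: Aut_QS_lex_def)
  then show ?thesis
    using subgroup.subgroup_is_group[OF subgroup_Aut_QS_lex group_BijGroup] by metis
qed

interpretation Aut: group "Aut_QS_lex S" for S
  by (rule group_Aut_QS_lex)

abbreviation Aut_inv :: "real set \<Rightarrow> ((real \<Rightarrow> rat) \<Rightarrow> (real \<Rightarrow> rat)) \<Rightarrow> (real \<Rightarrow> rat) \<Rightarrow> (real \<Rightarrow> rat)" where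
  "Aut_inv S \<equiv> m_inv (Aut_QS_lex S)"

lemma Aut_QS_mem: "f \<in> carrier (Aut_QS_lex S) \<Longrightarrow> x \<in> QS S \<Longrightarrow> f x \<in> QS S"
  by (auto simp: carrier_Aut_QS_lex_iff dest: Bij_imp_funcset)

lemma Aut_QS_eqI:
  "f \<in> carrier (Aut_QS_lex S) \<Longrightarrow> g \<in> carrier (Aut_QS_lex S) \<Longrightarrow> (\<And>x. x \<in> QS S \<Longrightarrow> f x = g x) \<Longrightarrow> f = g"
  by (auto simp: carrier_Aut_QS_lex_iff intro: extensionalityI dest: Bij_imp_extensional)

lemma Aut_QS_one: "\<one>\<^bsub>Aut_QS_lex S\<^esub> = (\<lambda>x\<in>QS S. x)"
  by (simp add: Aut_QS_lex_def BijGroup_def)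

lemma Aut_QS_mult:
  "f \<in> carrier (Aut_QS_lex S) \<Longrightarrow> g \<in> carrier (Aut_QS_lex S) \<Longrightarrow>
   f \<otimes>\<^bsub>Aut_QS_lex S\<^esub> g = compose (QS S) f g"
  by (simp add: Aut_QS_lex_def BijGroup_def)

lemma Aut_QS_mult_apply:
  "f \<in> carrier (Aut_QS_lex S) \<Longrightarrow> g \<in> carrier (Aut_QS_lex S) \<Longrightarrow> x \<in> QS S \<Longrightarrow>
   (f \<otimes>\<^bsub>Aut_QS_lex S\<^esub> g) x = f (g x)"
  by (simp add: Aut_QS_mult compose_eq)

lemma
  assumes "f \<in> carrier (Aut_QS_lex S)" "x \<in> QS S"
  shows Aut_QS_inv_apply: "Aut_inv S f (f x) = x"
    and Aut_QS_apply_inv: "f (Aut_inv S f x) = x"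
proof -
  have "Aut_inv S f \<in> carrier (Aut_QS_lex S)"
    using assms(1) by simp
  then show "Aut_inv S f (f x) = x" "f (Aut_inv S f x) = x"
    using assms Aut.l_inv[OF assms(1)] Aut.r_inv[OF assms(1)]
    by (metis Aut_QS_mult_apply Aut_QS_one restrict_apply')+
qed

section \<open>Level maps and level subgroups\<close>

text \<open>For \<open>p\<close> in \<open>rat_aut\<close>, these are the elements of the copy of
  Aut(Q, <) at level \<open>s\<close> over the prefix of \<open>a\<close>. Restriction to
  \<open>QS S\<close> makes them extensional, as \<open>Bij\<close> demands.\<close>

definition level_map ::
    "real set \<Rightarrow> real \<Rightarrow> (real \<Rightarrow> rat) \<Rightarrow> (rat \<Rightarrow> rat) \<Rightarrow> (real \<Rightarrow> rat) \<Rightarrow> (real \<Rightarrow> rat)" where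
  "level_map S s a p = (\<lambda>x\<in>QS S. if agree_above S s x a then x(s := p (x s)) else x)"

lemma level_map_apply:
  "x \<in> QS S \<Longrightarrow> level_map S s a p x = (if agree_above S s x a then x(s := p (x s)) else x)"
  by (simp add: level_map_def)

lemma level_map_mem: "x \<in> QS S \<Longrightarrow> s \<in> S \<Longrightarrow> level_map S s a p x \<in> QS S"
  by (simp add: level_map_apply QS_upd)

lemma level_map_comp:
  "x \<in> QS S \<Longrightarrow> s \<in> S \<Longrightarrow> level_map S s a p (level_map S s a q x) = level_map S s a (p \<circ> q) x"
  by (simp add: level_map_apply QS_upd)

lemma level_map_id: "x \<in> QS S \<Longrightarrow> level_map S s a id x = x"
  by (simp add: level_map_apply)

text \<open>A comparison at a level above \<open>s\<close> does not see coordinate \<open>s\<close>.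
  At a level up to \<open>s\<close>, the two points share their prefix above \<open>s\<close>, so
  \<open>p\<close> is applied to both or to neither.\<close>

lemma level_map_Aut:
  assumes "s \<in> S" "p \<in> rat_aut"
  shows "level_map S s a p \<in> carrier (Aut_QS_lex S)"
  unfolding carrier_Aut_QS_lex_iff
proof (intro conjI ballI impI)
  note p = inv_rat_aut[OF assms(2)]
  have "bij_betw (level_map S s a p) (QS S) (QS S)"
    by (rule bij_betw_byWitness[where f' = "level_map S s a (inv p)"])
      (auto simp: level_map_comp level_map_mem assms(1) p level_map_id)
  then show "level_map S s a p \<in> Bij (QS S)"
    by (simp add: Bij_def level_map_def)
next
  fix x y t assume x: "x \<in> QS S" "y \<in> QS S" and t: "t \<in> S" "agree_above S t x y"
  have p: "p q < p r \<longleftrightarrow> q < r" for q r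
    using assms(2) by (simp add: rat_aut_def strict_mono_less)
  have iff: "agree_above S s x a \<longleftrightarrow> agree_above S s y a" if "t \<le> s"
    using t(2) that by (auto simp: agree_above_def)
  show "agree_above S t (level_map S s a p x) (level_map S s a p y)"
    using t iff x assms(1) by (auto simp: level_map_apply agree_above_def)
  show "x t < y t \<longleftrightarrow> level_map S s a p x t < level_map S s a p y t"
    using t iff x assms(1) p by (cases "t = s") (auto simp: level_map_apply)
qed

text \<open>Among points with the prefix of \<open>a\<close> above \<open>s\<close>,
  \<open>f\<close> preserves and reflects equality at \<open>s\<close>, so \<open>f x s\<close>
  depends on \<open>x s\<close> alone. To hit \<open>r\<close>, pull back \<open>f a\<close> with
  coordinate \<open>s\<close> set to \<open>r\<close>; the preimage has the prefix of
  \<open>a\<close>.\<close>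

lemma Aut_QS_local_map:
  assumes f: "f \<in> carrier (Aut_QS_lex S)" and a: "a \<in> QS S" and s: "s \<in> S"
  shows "(\<lambda>q. f (a(s := q)) s) \<in> rat_aut"
    and "\<And>x. x \<in> QS S \<Longrightarrow> agree_above S s x a \<Longrightarrow> f x s = f (a(s := x s)) s"
proof -
  have upd: "a(s := q) \<in> QS S" for q
    using a s by (rule QS_upd)
  have ag: "agree_above S s (a(s := q)) (a(s := r))" for q r
    by (simp add: agree_above_def)
  show *: "f x s = f (a(s := x s)) s" if "x \<in> QS S" "agree_above S s x a" for x
    using Aut_QS_eq_iff[OF f that(1) upd[of "x s"] s] that(2) by (auto simp: agree_above_def)
  show "(\<lambda>q. f (a(s := q)) s) \<in> rat_aut"
  proof (rule rat_autI)
    show "strict_mono (\<lambda>q. f (a(s := q)) s)"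
      using Aut_QS_less_iff[OF f upd upd s ag] by (simp add: strict_mono_def)
    show "surj (\<lambda>q. f (a(s := q)) s)"
    proof (rule surjI)
      fix r
      define y where "y = (f a)(s := r)"
      have y: "y \<in> QS S"
        unfolding y_def by (rule QS_upd[OF Aut_QS_mem[OF f a] s])
      define x where "x = Aut_inv S f y"
      have x: "x \<in> QS S" "f x = y"
        using y f by (simp_all add: x_def Aut_QS_mem Aut_QS_apply_inv)
      have "agree_above S s x a"
        using Aut_QS_agree_above_iff[OF f x(1) a s] by (simp add: x(2) y_def agree_above_refl)
      then show "f (a(s := Aut_inv S f ((f a)(s := r)) s)) s = r"
        using *[OF x(1)] x(2) by (simp add: y_def x_def)
    qed
  qed
qed

text \<open>An intrinsic description of the group \<open>K s a\<close>: a conjugate can be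
  recognised by which coordinates and points it moves, without computing the underlying map of the
  rationals.\<close>

definition level_subgroup ::
    "real set \<Rightarrow> real \<Rightarrow> (real \<Rightarrow> rat) \<Rightarrow> ((real \<Rightarrow> rat) \<Rightarrow> (real \<Rightarrow> rat)) set" where
  "level_subgroup S s a = {f \<in> carrier (Aut_QS_lex S). \<forall>x\<in>QS S.
     (\<forall>t\<in>S. t \<noteq> s \<longrightarrow> f x t = x t) \<and> (\<not> agree_above S s x a \<longrightarrow> f x = x)}"

lemma level_subgroup_eq:
  assumes "s \<in> S" "a \<in> QS S"
  shows "level_subgroup S s a = level_map S s a ` rat_aut"
proof (intro equalityI subsetI)
  fix f assume f: "f \<in> level_subgroup S s a"
  then have fG: "f \<in> carrier (Aut_QS_lex S)"
    by (simp add: level_subgroup_def)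
  define p where "p q = f (a(s := q)) s" for q
  have p: "p \<in> rat_aut" "\<And>x. x \<in> QS S \<Longrightarrow> agree_above S s x a \<Longrightarrow> f x s = p (x s)"
    using Aut_QS_local_map[OF fG assms(2,1)] by (simp_all add: p_def[abs_def])
  have "f = level_map S s a p"
  proof (rule Aut_QS_eqI[OF fG level_map_Aut[OF assms(1) p(1)]])
    fix x assume x: "x \<in> QS S"
    show "f x = level_map S s a p x"
    proof (cases "agree_above S s x a")
      case True
      show ?thesis
      proof (rule QS_eqI[OF Aut_QS_mem[OF fG x] level_map_mem[OF x assms(1)]])
        fix t assume "t \<in> S"
        then show "f x t = level_map S s a p x t"
          using f x p(2)[OF x True] True
          by (cases "t = s") (simp_all add: level_subgroup_def level_map_apply)
      qed
    qed (use f x in \<open>simp add: level_subgroup_def level_map_apply\<close>)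
  qed
  then show "f \<in> level_map S s a ` rat_aut"
    using p(1) by blast
qed (use assms(1) in \<open>auto simp: level_subgroup_def level_map_Aut level_map_apply\<close>)

lemma level_subgroup_cong:
  assumes "agree_above S s a b"
  shows "level_subgroup S s a = level_subgroup S s b"
proof -
  have "agree_above S s x a \<longleftrightarrow> agree_above S s x b" for x
    using assms agree_above_trans agree_above_sym by blast
  then show ?thesis
    by (simp add: level_subgroup_def)
qed

text \<open>Below \<open>s\<close>, neither \<open>f\<close> nor \<open>k\<close> changes anything.
  Above \<open>s\<close>, \<open>f\<close> keeps the prefix of \<open>k x\<close>, and the inverse
  of \<open>k\<close> respects equality of prefixes. A point whose prefix differs from that of
  \<open>Aut_inv S k b\<close> is sent by \<open>k\<close> to one whose prefix differs from that of
  \<open>b\<close>, where \<open>f\<close> is the identity.\<close>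

lemma level_subgroup_conj:
  assumes s: "s \<in> S" and b: "b \<in> QS S" and f: "f \<in> level_subgroup S s b"
    and k: "k \<in> carrier (Aut_QS_lex S)"
    and low: "\<And>x t. x \<in> QS S \<Longrightarrow> t \<in> S \<Longrightarrow> t < s \<Longrightarrow> k x t = x t"
  shows "Aut_inv S k \<otimes>\<^bsub>Aut_QS_lex S\<^esub> (f \<otimes>\<^bsub>Aut_QS_lex S\<^esub> k) \<in> level_subgroup S s (Aut_inv S k b)"
    (is "?g \<in> _")
proof -
  have fG: "f \<in> carrier (Aut_QS_lex S)"
    using f by (simp add: level_subgroup_def)
  have g: "?g x = Aut_inv S k (f (k x))" if "x \<in> QS S" for x
    using that k fG by (simp add: Aut_QS_mult_apply Aut_QS_mem)
  have ik: "Aut_inv S k \<in> carrier (Aut_QS_lex S)"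
    using k by simp
  have low': "Aut_inv S k x t = x t" if "x \<in> QS S" "t \<in> S" "t < s" for x t
    using low[OF Aut_QS_mem[OF ik that(1)] that(2,3)] by (simp add: Aut_QS_apply_inv[OF k that(1)])
  have "?g \<in> carrier (Aut_QS_lex S)"
    using k fG by simp
  moreover have "?g x t = x t" if x: "x \<in> QS S" and t: "t \<in> S" "t \<noteq> s" for x t
  proof (cases "t < s")
    case True
    have "f (k x) t = k x t"
      using f x t Aut_QS_mem[OF k x] by (simp add: level_subgroup_def)
    then show ?thesis
      using True x t k fG by (simp add: g low low' Aut_QS_mem)
  next
    case False
    have kx: "k x \<in> QS S" "f (k x) \<in> QS S"
      using k fG x by (simp_all add: Aut_QS_mem)
    have "agree_above S s (f (k x)) (k x)"
      using f kx(1) by (auto simp: level_subgroup_def agree_above_def)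
    then have "agree_above S s (Aut_inv S k (f (k x))) (Aut_inv S k (k x))"
      using Aut_QS_agree_above_iff[OF ik kx(2,1) s] by blast
    then show ?thesis
      using False t x k by (simp add: g agree_above_def Aut_QS_inv_apply)
  qed
  moreover have "?g x = x" if x: "x \<in> QS S" and n: "\<not> agree_above S s x (Aut_inv S k b)" for x
  proof -
    have "\<not> agree_above S s (k x) b"
      using n Aut_QS_agree_above_iff[OF k x Aut_QS_mem[OF ik b] s] Aut_QS_apply_inv[OF k b] by simp
    then have "f (k x) = k x"
      using f Aut_QS_mem[OF k x] by (simp add: level_subgroup_def)
    then show ?thesis
      using x k by (simp add: g Aut_QS_inv_apply)
  qed
  ultimately show ?thesis
    by (simp add: level_subgroup_def)
qed

section \<open>Density of the level subgroups\<close>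

text \<open>Matching \<open>g\<close> on finite sets is density for pointwise convergence;
  \<open>H\<close> will be the stabiliser of a point. The induction counts the pairs of a level and
  a prefix above it at which \<open>g\<close> moves a point of \<open>F\<close>.\<close>

lemma level_subgroups_dense:
  assumes HG: "H \<subseteq> carrier (Aut_QS_lex S)"
    and one: "\<one>\<^bsub>Aut_QS_lex S\<^esub> \<in> H"
    and mult: "\<And>f g. f \<in> H \<Longrightarrow> g \<in> H \<Longrightarrow> f \<otimes>\<^bsub>Aut_QS_lex S\<^esub> g \<in> H"
    and level: "\<And>s a. s \<in> S \<Longrightarrow> a \<in> QS S \<Longrightarrow> level_subgroup S s a \<subseteq> H"
    and F: "finite F" "F \<subseteq> QS S"
    and g: "g \<in> carrier (Aut_QS_lex S)"
  shows "\<exists>h\<in>H. \<forall>x\<in>F. h x = g x"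
proof -
  define trunc where "trunc s x = (\<lambda>t\<in>S. if s < t then x t else (0 :: rat))" for s :: real and x
  have trunc: "trunc s x = trunc s y \<longleftrightarrow> agree_above S s x y" for s x y
    by (auto simp: trunc_def agree_above_def restrict_def fun_eq_iff)
  define N where "N g = {(s, trunc s x) | s x. s \<in> S \<and> x \<in> F \<and> g x s \<noteq> x s}"
    for g :: "(real \<Rightarrow> rat) \<Rightarrow> (real \<Rightarrow> rat)"
  have finN: "finite (N g)" if g: "g \<in> carrier (Aut_QS_lex S)" for g
  proof -
    have "N g \<subseteq> (\<Union>x\<in>F. (\<lambda>s. (s, trunc s x)) ` ({s \<in> S. g x s \<noteq> 0} \<union> {s \<in> S. x s \<noteq> 0}))"
      by (force simp: N_def)
    moreover have "finite {s \<in> S. x s \<noteq> 0}" "finite {s \<in> S. g x s \<noteq> 0}" if "x \<in> F" for x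
      using that F(2) Aut_QS_mem[OF g, of x] by (auto simp: QS_def)
    ultimately show ?thesis
      using F(1) by (elim finite_subset) simp
  qed
  \<comment> \<open>\<open>trunc s x\<close> is a canonical representative of the prefix of \<open>x\<close> above \<open>s\<close>; removing the
    top element of \<open>N g\<close> by one level map leaves the pairs below it unchanged.\<close>
  show ?thesis
    using g
  proof (induction "card (N g)" arbitrary: g rule: less_induct)
    case less
    note gG = less.prems
    show ?case
    proof (cases "N g = {}")
      case True
      have "g x = x" if "x \<in> F" for x
        using that True F(2) by (intro QS_eqI[of _ S] Aut_QS_mem[OF gG]) (auto simp: N_def)
      then show ?thesis
        using one F(2) by (intro bexI[of _ "\<one>\<^bsub>Aut_QS_lex S\<^esub>"]) (auto simp: Aut_QS_one)
    next
      case False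
      define s where "s = Max (fst ` N g)"
      have s_max: "t \<le> s" if "(t, u) \<in> N g" for t u
        unfolding s_def using finN[OF gG] that by (intro Max_ge) (auto intro: rev_image_eqI)
      have "s \<in> fst ` N g"
        unfolding s_def using False finN[OF gG] by (intro Max_in) auto
      then obtain a where s: "s \<in> S" and a: "a \<in> F" "g a s \<noteq> a s"
        using False by (auto simp: N_def)
      have aQ: "a \<in> QS S"
        using a(1) F(2) by blast
      \<comment> \<open>By maximality of \<open>s\<close>, \<open>g x\<close> has the prefix of
        \<open>x\<close> above \<open>s\<close>. So the level map of \<open>inv p\<close> undoes
        exactly what \<open>g\<close> does to coordinate \<open>s\<close> of the points of
        \<open>F\<close> over the prefix of \<open>a\<close>.\<close>
      have above: "agree_above S s (g x) x" if "x \<in> F" for x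
        using s_max that by (force simp: agree_above_def N_def)
      define p where "p q = g (a(s := q)) s" for q
      have p: "p \<in> rat_aut" "\<And>x. x \<in> QS S \<Longrightarrow> agree_above S s x a \<Longrightarrow> g x s = p (x s)"
        using Aut_QS_local_map[OF gG aQ s] by (simp_all add: p_def[abs_def])
      note ip = inv_rat_aut[OF p(1)]
      define k where "k = level_map S s a p"
      define k' where "k' = level_map S s a (inv p)"
      have kG: "k \<in> carrier (Aut_QS_lex S)" "k' \<in> carrier (Aut_QS_lex S)" "k \<in> H"
        using level_map_Aut[OF s] p(1) ip(1) level[OF s aQ] level_subgroup_eq[OF s aQ]
        by (auto simp: k_def k'_def)
      have kk': "k (k' x) = x" if "x \<in> QS S" for x
        using that s by (simp add: k_def k'_def level_map_comp ip level_map_id)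
      define g' where "g' = k' \<otimes>\<^bsub>Aut_QS_lex S\<^esub> g"
      have g'G: "g' \<in> carrier (Aut_QS_lex S)"
        using kG gG by (simp add: g'_def)
      have g': "g' x = (if agree_above S s x a then (g x)(s := x s) else g x)" if "x \<in> F" for x
      proof -
        have x: "x \<in> QS S"
          using that F(2) by blast
        have "agree_above S s (g x) a \<longleftrightarrow> agree_above S s x a"
          using above[OF that] agree_above_trans agree_above_sym by blast
        moreover have "inv p (p (x s)) = x s"
          using ip(3) by (metis comp_apply id_apply)
        ultimately show ?thesis
          using x kG gG p(2)[OF x]
          by (auto simp: g'_def Aut_QS_mult_apply k'_def level_map_apply Aut_QS_mem fun_eq_iff)
      qed
      have "g x t \<noteq> x t" if "x \<in> F" "g' x t \<noteq> x t" for x t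
        using g'[OF that(1)] that(2) by (auto split: if_splits)
      then have "N g' \<subseteq> N g"
        unfolding N_def by blast
      moreover have "(s, trunc s a) \<in> N g"
        using s a by (auto simp: N_def)
      moreover have "(s, trunc s a) \<notin> N g'"
        using g' by (auto simp: N_def trunc agree_above_sym)
      ultimately have "card (N g') < card (N g)"
        using finN[OF gG] by (metis psubsetI psubset_card_mono)
      then obtain h where h: "h \<in> H" "\<forall>x\<in>F. h x = g' x"
        using less.hyps g'G by blast
      have "(k \<otimes>\<^bsub>Aut_QS_lex S\<^esub> h) x = g x" if "x \<in> F" for x
      proof -
        have x: "x \<in> QS S"
          using that F(2) by blast
        then show ?thesis
          using h that kG gG HG by (simp add: Aut_QS_mult_apply subset_iff g'_def kk' Aut_QS_mem)
      qed
      then show ?thesis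
        using mult[OF kG(3) h(1)] by blast
    qed
  qed
qed

section \<open>Fixed points of flows\<close>

lemma topspace_pointwise_topology: "topspace (pointwise_topology S) = carrier (Aut_QS_lex S)"
proof -
  have "carrier (Aut_QS_lex S) \<subseteq> QS S \<rightarrow>\<^sub>E QS S"
    by (auto simp: PiE_def dest: Aut_QS_mem)
      (auto simp: carrier_Aut_QS_lex_iff dest: Bij_imp_extensional)
  then show ?thesis
    by (auto simp: pointwise_topology_def)
qed

lemma openin_pointwise_topology_eval:
  assumes "x \<in> QS S"
  shows "openin (pointwise_topology S) {g \<in> carrier (Aut_QS_lex S). g x = y}"
proof (cases "y \<in> QS S")
  case True
  have "continuous_map (pointwise_topology S) (discrete_topology (QS S)) (\<lambda>g. g x)"
    unfolding pointwise_topology_def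
    by (intro continuous_map_from_subtopology continuous_map_product_projection assms)
  then have "openin (pointwise_topology S) {g \<in> topspace (pointwise_topology S). g x \<in> {y}}"
    by (rule openin_continuous_map_preimage) (use True in simp)
  then show ?thesis
    by (simp add: topspace_pointwise_topology)
next
  case False
  then have "{g \<in> carrier (Aut_QS_lex S). g x = y} = {}"
    using Aut_QS_mem assms by blast
  then show ?thesis
    by (simp only: openin_empty)
qed

text \<open>A basic open box constrains only finitely many arguments; these form
  \<open>F\<close>.\<close>

lemma pointwise_topology_nbhd:
  assumes "openin (pointwise_topology S) V" "g \<in> V"
  shows "\<exists>F. finite F \<and> F \<subseteq> QS S \<and> (\<forall>h\<in>carrier (Aut_QS_lex S). (\<forall>x\<in>F. h x = g x) \<longrightarrow> h \<in> V)"
proof -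
  obtain W where W: "openin (product_topology (\<lambda>_. discrete_topology (QS S)) (QS S)) W"
    "V = W \<inter> carrier (Aut_QS_lex S)"
    using assms(1) by (auto simp: pointwise_topology_def openin_subtopology)
  then obtain U where U: "finite {x \<in> QS S. U x \<noteq> QS S}" "g \<in> Pi\<^sub>E (QS S) U" "Pi\<^sub>E (QS S) U \<subseteq> W"
    using assms(2) unfolding openin_product_topology_alt by fastforce
  have "h \<in> V" if h: "h \<in> carrier (Aut_QS_lex S)" "\<forall>x\<in>{x \<in> QS S. U x \<noteq> QS S}. h x = g x" for h
  proof -
    have "h x \<in> U x" if x: "x \<in> QS S" for x
      using U(2) h x Aut_QS_mem[OF h(1) x] by (cases "U x = QS S") auto
    moreover have "h \<in> extensional (QS S)"
      using h(1) by (auto simp: carrier_Aut_QS_lex_iff dest: Bij_imp_extensional)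
    ultimately show ?thesis
      using U(3) h(1) W(2) by (auto simp: PiE_def)
  qed
  then show ?thesis
    using U(1) by (intro exI[of _ "{x \<in> QS S. U x \<noteq> QS S}"]) auto
qed

text \<open>The factors are discrete, so it suffices that every fibre of every evaluation is
  open.\<close>

lemma continuous_map_pointwise_topology:
  assumes mem: "\<And>u. u \<in> topspace T \<Longrightarrow> f u \<in> carrier (Aut_QS_lex S)"
    and op: "\<And>x y. x \<in> QS S \<Longrightarrow> openin T {u \<in> topspace T. f u x = y}"
  shows "continuous_map T (pointwise_topology S) f"
  unfolding pointwise_topology_def
proof (intro continuous_map_into_subtopology)
  show "continuous_map T (product_topology (\<lambda>_. discrete_topology (QS S)) (QS S)) f"
    unfolding continuous_map_componentwise
  proof (intro conjI ballI)
    show "f ` topspace T \<subseteq> extensional (QS S)"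
      using mem by (auto simp: carrier_Aut_QS_lex_iff dest: Bij_imp_extensional)
  next
    fix x assume x: "x \<in> QS S"
    show "continuous_map T (discrete_topology (QS S)) (\<lambda>u. f u x)"
      unfolding continuous_map_def
    proof (intro conjI allI impI)
      show "(\<lambda>u. f u x) \<in> topspace T \<rightarrow> topspace (discrete_topology (QS S))"
        using mem x Aut_QS_mem by fastforce
      fix U
      have "{u \<in> topspace T. f u x \<in> U} = (\<Union>y\<in>U. {u \<in> topspace T. f u x = y})"
        by auto
      then show "openin T {u \<in> topspace T. f u x \<in> U}"
        using op[OF x] by (auto intro!: openin_Union)
    qed
  qed
qed (use mem in auto)

lemma topological_group_Aut_QS_lex: "topological_group (Aut_QS_lex S) (pointwise_topology S)"
  unfolding topological_group_def
proof (intro conjI group_Aut_QS_lex topspace_pointwise_topology continuous_map_pointwise_topology)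
  let ?T = "pointwise_topology S"
  have eval: "openin ?T {g \<in> carrier (Aut_QS_lex S). g x = y}" if "x \<in> QS S" for x y
    using openin_pointwise_topology_eval[OF that] .
  fix x y assume x: "x \<in> QS S"
  \<comment> \<open>Sorting the pairs by the intermediate value \<open>z = h x\<close> writes the
    preimage as a union of open rectangles.\<close>
  have "{u \<in> topspace (prod_topology ?T ?T). (case u of (g, h) \<Rightarrow> g \<otimes>\<^bsub>Aut_QS_lex S\<^esub> h) x = y} =
      (\<Union>z\<in>QS S. {g \<in> carrier (Aut_QS_lex S). g z = y} \<times> {h \<in> carrier (Aut_QS_lex S). h x = z})"
    using x by (auto simp: topspace_pointwise_topology Aut_QS_mult_apply Aut_QS_mem)
  then show "openin (prod_topology ?T ?T)
      {u \<in> topspace (prod_topology ?T ?T). (case u of (g, h) \<Rightarrow> g \<otimes>\<^bsub>Aut_QS_lex S\<^esub> h) x = y}"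
    using x by (auto intro!: openin_Union simp: openin_prod_Times_iff eval)
  show "openin ?T {g \<in> topspace ?T. Aut_inv S g x = y}"
  proof (cases "y \<in> QS S")
    case True
    then have "{g \<in> topspace ?T. Aut_inv S g x = y} = {g \<in> carrier (Aut_QS_lex S). g y = x}"
      using x by (auto simp: topspace_pointwise_topology Aut_QS_inv_apply Aut_QS_apply_inv)
    then show ?thesis
      using eval[OF True] by simp
  next
    case False
    then have "{g \<in> topspace ?T. Aut_inv S g x = y} = {}"
      using x Aut_QS_mem[OF Aut.inv_closed] by (auto simp: topspace_pointwise_topology)
    then show ?thesis
      by (simp only: openin_empty)
  qed
qed (auto simp: topspace_pointwise_topology)

section \<open>Fixed point sets of a flow\<close>

locale Aut_QS_flow =
  fixes S :: "real set" and X :: "'x topology"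
    and \<phi> :: "((real \<Rightarrow> rat) \<Rightarrow> (real \<Rightarrow> rat)) \<Rightarrow> 'x \<Rightarrow> 'x"
  assumes compact: "compact_space X" and Hausdorff: "Hausdorff_space X"
    and nonempty: "topspace X \<noteq> {}"
    and action: "continuous_action (Aut_QS_lex S) (pointwise_topology S) X \<phi>"
begin

abbreviation "G \<equiv> Aut_QS_lex S"

lemma hom: "\<phi> \<in> hom G (BijGroup (topspace X))"
  using action by (simp add: continuous_action_def group_action_def group_hom_def group_hom_axioms_def)

lemma act_Bij: "g \<in> carrier G \<Longrightarrow> \<phi> g \<in> Bij (topspace X)"
  using hom by (auto simp: hom_def BijGroup_def)

lemma act_mem: "g \<in> carrier G \<Longrightarrow> x \<in> topspace X \<Longrightarrow> \<phi> g x \<in> topspace X"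
  using act_Bij[THEN Bij_imp_funcset] by blast

lemma act_mult:
  assumes "g \<in> carrier G" "h \<in> carrier G" "x \<in> topspace X"
  shows "\<phi> (g \<otimes>\<^bsub>G\<^esub> h) x = \<phi> g (\<phi> h x)"
proof -
  have "\<phi> (g \<otimes>\<^bsub>G\<^esub> h) = \<phi> g \<otimes>\<^bsub>BijGroup (topspace X)\<^esub> \<phi> h"
    using hom assms by (simp add: hom_def)
  then show ?thesis
    using assms act_Bij by (simp add: BijGroup_def compose_eq)
qed

lemma act_one:
  assumes "x \<in> topspace X"
  shows "\<phi> \<one>\<^bsub>G\<^esub> x = x"
proof -
  have "\<phi> \<one>\<^bsub>G\<^esub> = \<one>\<^bsub>BijGroup (topspace X)\<^esub>"
    using hom_one[OF hom group_Aut_QS_lex group_BijGroup] .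
  then show ?thesis
    using assms by (simp add: BijGroup_def)
qed

text \<open>Joint continuity, with the neighbourhood of \<open>g\<close> expressed by finitely many
  values. Both the transfer from the rationals and the density argument use this form.\<close>

lemma act_continuous:
  assumes g: "g \<in> carrier G" and x: "x \<in> topspace X" and U: "openin X U" "\<phi> g x \<in> U"
  shows "\<exists>F W. finite F \<and> F \<subseteq> QS S \<and> openin X W \<and> x \<in> W \<and>
    (\<forall>h\<in>carrier G. (\<forall>z\<in>F. h z = g z) \<longrightarrow> (\<forall>y\<in>W. \<phi> h y \<in> U))"
proof -
  let ?P = "prod_topology (pointwise_topology S) X"
  let ?V = "{p \<in> topspace ?P. (case p of (g, x) \<Rightarrow> \<phi> g x) \<in> U}"
  have "openin ?P ?V"
    using action U(1) unfolding continuous_action_def by (intro openin_continuous_map_preimage) blast+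
  moreover have "(g, x) \<in> ?V"
    using g x U(2) by (simp add: topspace_pointwise_topology)
  ultimately obtain O1 W where O: "openin (pointwise_topology S) O1" "openin X W" "g \<in> O1" "x \<in> W"
    "O1 \<times> W \<subseteq> ?V"
    unfolding openin_prod_topology_alt by meson
  obtain F where F: "finite F" "F \<subseteq> QS S" "\<forall>h\<in>carrier G. (\<forall>x\<in>F. h x = g x) \<longrightarrow> h \<in> O1"
    using pointwise_topology_nbhd[OF O(1,3)] by blast
  have "\<phi> h y \<in> U" if "h \<in> O1" "y \<in> W" for h y
    using subsetD[OF O(5), of "(h, y)"] that by simp
  then show ?thesis
    using F O(2,4) by (intro exI[of _ F] exI[of _ W]) simp
qed

definition Fix :: "((real \<Rightarrow> rat) \<Rightarrow> (real \<Rightarrow> rat)) set \<Rightarrow> 'x set" where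
  "Fix A = {x \<in> topspace X. \<forall>g\<in>A. \<phi> g x = x}"

lemma closedin_Fix:
  assumes "A \<subseteq> carrier G"
  shows "closedin X (Fix A)"
\<comment> \<open>An intersection over the empty index set would be the whole type instead of
  \<open>topspace X\<close>.\<close>
proof (cases "A = {}")
  case False
  have "closedin X {x \<in> topspace X. \<phi> g x = x}" if "g \<in> A" for g
  proof (rule closedin_continuous_maps_eq[OF Hausdorff])
    have "continuous_map X (prod_topology (pointwise_topology S) X) (\<lambda>x. (g, x))"
      using that assms by (auto simp: continuous_map_pairedI topspace_pointwise_topology)
    then show "continuous_map X X (\<phi> g)"
      using action continuous_map_compose
      by (fastforce simp: continuous_action_def comp_def)
  qed simp
  moreover have "Fix A = (\<Inter>g\<in>A. {x \<in> topspace X. \<phi> g x = x})"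
    using False by (auto simp: Fix_def)
  ultimately show ?thesis
    using False by (auto intro!: closedin_Inter)
qed (simp add: Fix_def)

text \<open>The finite intersection property, applied to \<open>C\<close> and the closed sets
  \<open>Fix (A i)\<close>. It reduces all prefixes, and later all levels, to finitely many at a
  time.\<close>

lemma Fix_Union_nonempty:
  assumes C: "closedin X C" and A: "\<And>i. i \<in> I \<Longrightarrow> A i \<subseteq> carrier G"
    and fin: "\<And>J. finite J \<Longrightarrow> J \<subseteq> I \<Longrightarrow> C \<inter> Fix (\<Union>i\<in>J. A i) \<noteq> {}"
  shows "C \<inter> Fix (\<Union>i\<in>I. A i) \<noteq> {}"
proof -
  let ?\<U> = "insert C ((\<lambda>i. Fix (A i)) ` I)"
  have "\<forall>D\<in>?\<U>. closedin X D"
    using C A closedin_Fix by auto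
  moreover have "\<Inter>\<F> \<noteq> {}" if \<F>: "finite \<F>" "\<F> \<subseteq> ?\<U>" for \<F>
  proof -
    have "finite (\<F> - {C})" "\<F> - {C} \<subseteq> (\<lambda>i. Fix (A i)) ` I"
      using \<F> by auto
    then obtain J where J: "J \<subseteq> I" "finite J" "\<F> - {C} = (\<lambda>i. Fix (A i)) ` J"
      by (meson finite_subset_image)
    have "C \<inter> Fix (\<Union>i\<in>J. A i) \<subseteq> D" if "D \<in> \<F>" for D
      using that J(3) by (cases "D = C") (auto simp: Fix_def)
    then show ?thesis
      using fin[OF J(2,1)] by blast
  qed
  ultimately have "\<Inter>?\<U> \<noteq> {}"
    using compact[unfolded compact_space_fip, rule_format, of ?\<U>] by simp
  moreover have "\<Inter>?\<U> \<subseteq> C \<inter> Fix (\<Union>i\<in>I. A i)"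
    using closedin_subset[OF C] by (fastforce simp: Fix_def)
  ultimately show ?thesis
    by blast
qed

text \<open>Since \<open>f k = k (k^-1 f k)\<close> and the conjugate in brackets fixes
  \<open>x\<close>, the element \<open>f\<close> fixes the image of \<open>x\<close> under
  \<open>k\<close>.\<close>

lemma Fix_invariant:
  assumes A: "A \<subseteq> carrier G" and k: "k \<in> carrier G" and x: "x \<in> Fix A"
    and conj: "\<And>f. f \<in> A \<Longrightarrow> Aut_inv S k \<otimes>\<^bsub>G\<^esub> (f \<otimes>\<^bsub>G\<^esub> k) \<in> A"
  shows "\<phi> k x \<in> Fix A"
proof -
  have xX: "x \<in> topspace X"
    using x by (simp add: Fix_def)
  have "\<phi> f (\<phi> k x) = \<phi> k x" if f: "f \<in> A" for f
  proof -
    let ?g = "Aut_inv S k \<otimes>\<^bsub>G\<^esub> (f \<otimes>\<^bsub>G\<^esub> k)"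
    have fG: "f \<in> carrier G" and gG: "?g \<in> carrier G"
      using f A conj by auto
    have "\<phi> f (\<phi> k x) = \<phi> (f \<otimes>\<^bsub>G\<^esub> k) x"
      using fG k xX by (simp add: act_mult)
    also have "f \<otimes>\<^bsub>G\<^esub> k = k \<otimes>\<^bsub>G\<^esub> ?g"
      using fG k by (simp flip: Aut.m_assoc)
    also have "\<phi> \<dots> x = \<phi> k (\<phi> ?g x)"
      using k gG xX by (rule act_mult)
    also have "\<phi> ?g x = x"
      using x conj[OF f] by (simp add: Fix_def)
    finally show ?thesis .
  qed
  then show ?thesis
    using act_mem[OF k xX] by (simp add: Fix_def)
qed

text \<open>Transports the fixed point theorem for \<open>rat_aut\<close> along
  \<open>level_map S s a\<close>. Allowing any invariant closed \<open>C\<close> lets the search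
  continue inside fixed point sets found earlier.\<close>

lemma level_subgroup_fixed_point:
  assumes s: "s \<in> S" and a: "a \<in> QS S" and C: "closedin X C" "C \<noteq> {}"
    and inv: "\<And>k x. k \<in> level_subgroup S s a \<Longrightarrow> x \<in> C \<Longrightarrow> \<phi> k x \<in> C"
  shows "C \<inter> Fix (level_subgroup S s a) \<noteq> {}"
proof -
  define \<rho> where "\<rho> p = \<phi> (level_map S s a p)" for p
  have CX: "C \<subseteq> topspace X" "topspace (subtopology X C) = C"
    using closedin_subset[OF C(1)] by auto
  have lev: "level_map S s a p \<in> carrier G" if "p \<in> rat_aut" for p
    using level_map_Aut[OF s that] .
  have "\<exists>x\<in>topspace (subtopology X C). \<forall>p\<in>rat_aut. \<rho> p x = x"
  proof (rule rat_aut_fixed_point)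
    show "topspace (subtopology X C) \<noteq> {}"
      using C(2) CX(2) by simp
    show "compact_space (subtopology X C)"
      using closedin_compact_space[OF compact C(1)] by (simp add: compact_space_subtopology)
    show "Hausdorff_space (subtopology X C)"
      by (rule Hausdorff_space_subtopology[OF Hausdorff])
  next
    fix p x assume "p \<in> rat_aut" "x \<in> topspace (subtopology X C)"
    then show "\<rho> p x \<in> topspace (subtopology X C)"
      using inv CX by (auto simp: \<rho>_def level_subgroup_eq[OF s a])
  next
    fix x assume x: "x \<in> topspace (subtopology X C)"
    have "level_map S s a id = \<one>\<^bsub>G\<^esub>"
      by (rule Aut_QS_eqI[OF lev[OF id_rat_aut] Aut.one_closed]) (simp add: level_map_id Aut_QS_one)
    then show "\<rho> id x = x"
      using x by (simp add: \<rho>_def act_one)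
  next
    fix p q x assume pq: "p \<in> rat_aut" "q \<in> rat_aut" and x: "x \<in> topspace (subtopology X C)"
    have "level_map S s a (p \<circ> q) = level_map S s a p \<otimes>\<^bsub>G\<^esub> level_map S s a q"
      using lev pq s
      by (intro Aut_QS_eqI[of _ S]) (simp_all add: comp_rat_aut Aut_QS_mult_apply level_map_comp)
    then show "\<rho> (p \<circ> q) x = \<rho> p (\<rho> q x)"
      using x lev pq by (simp add: \<rho>_def act_mult)
  next
    fix p x U
    assume p: "p \<in> rat_aut" and x: "x \<in> topspace (subtopology X C)"
      and U: "openin (subtopology X C) U" "\<rho> p x \<in> U"
    obtain U' where U': "openin X U'" "U = U' \<inter> C"
      using U(1) by (auto simp: openin_subtopology)
    have xX: "x \<in> topspace X"
      using x by simp
    have "\<phi> (level_map S s a p) x \<in> U'"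
      using U(2) U'(2) by (simp add: \<rho>_def)
    from act_continuous[OF lev[OF p] xX U'(1) this]
    obtain F W where F: "finite F" "F \<subseteq> QS S" and W: "openin X W" "x \<in> W"
      and FW: "\<And>h y. h \<in> carrier G \<Longrightarrow> (\<forall>z\<in>F. h z = level_map S s a p z) \<Longrightarrow> y \<in> W \<Longrightarrow> \<phi> h y \<in> U'"
      by blast
    \<comment> \<open>On \<open>F\<close>, the level map of \<open>q\<close> depends only on the
      values of \<open>q\<close> at the coordinates \<open>z s\<close>, so agreement at these
      finitely many rationals is enough.\<close>
    have "\<rho> q y \<in> U"
      if q: "q \<in> rat_aut" "\<forall>r\<in>(\<lambda>z. z s) ` F. q r = p r" and y: "y \<in> W \<inter> C" for q y
    proof -
      have "\<forall>z\<in>F. level_map S s a q z = level_map S s a p z"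
        using q(2) F(2) by (auto simp: level_map_apply)
      then have "\<rho> q y \<in> U'"
        using FW[OF lev[OF q(1)]] y by (simp add: \<rho>_def)
      moreover have "\<rho> q y \<in> C"
        using inv q(1) y by (auto simp: \<rho>_def level_subgroup_eq[OF s a])
      ultimately show ?thesis
        using U'(2) by blast
    qed
    moreover have "openin (subtopology X C) (W \<inter> C)" "x \<in> W \<inter> C"
      using W x by (auto simp: openin_subtopology)
    ultimately show "\<exists>F W. finite F \<and> openin (subtopology X C) W \<and> x \<in> W \<and>
         (\<forall>q\<in>rat_aut. (\<forall>r\<in>F. q r = p r) \<longrightarrow> (\<forall>y\<in>W. \<rho> q y \<in> U))"
      using F(1) by (intro exI[of _ "(\<lambda>z. z s) ` F"] exI[of _ "W \<inter> C"]) blast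
  qed
  then show ?thesis
    using CX by (auto simp: Fix_def \<rho>_def level_subgroup_eq[OF s a])
qed

definition level_set :: "real \<Rightarrow> ((real \<Rightarrow> rat) \<Rightarrow> (real \<Rightarrow> rat)) set" where
  "level_set s = (\<Union>a\<in>QS S. level_subgroup S s a)"

lemma level_subgroup_subset: "level_subgroup S s a \<subseteq> carrier G"
  by (auto simp: level_subgroup_def)

lemma level_set_subset: "level_set s \<subseteq> carrier G"
  using level_subgroup_subset by (auto simp: level_set_def)

text \<open>Prefixes are added one at a time. An element \<open>k\<close> of a level subgroup at
  \<open>s\<close> changes no coordinate above \<open>s\<close>, so \<open>Aut_inv S k b\<close> has
  the prefix of \<open>b\<close>, and conjugation maps each level subgroup at \<open>s\<close> into
  itself. Hence the fixed points for the prefixes already treated are invariant under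
  \<open>k\<close>.\<close>

lemma level_set_fixed_point:
  assumes s: "s \<in> S" and C: "closedin X C" "C \<noteq> {}"
    and inv: "\<And>k x. k \<in> level_set s \<Longrightarrow> x \<in> C \<Longrightarrow> \<phi> k x \<in> C"
  shows "C \<inter> Fix (level_set s) \<noteq> {}"
  unfolding level_set_def
proof (rule Fix_Union_nonempty[OF C(1) level_subgroup_subset])
  fix B assume "finite B" "B \<subseteq> QS S"
  then show "C \<inter> Fix (\<Union>b\<in>B. level_subgroup S s b) \<noteq> {}"
  proof (induction B rule: finite_induct)
    case empty
    then show ?case
      using C closedin_subset[OF C(1)] by (auto simp: Fix_def)
  next
    case (insert a B)
    let ?A = "\<Union>b\<in>B. level_subgroup S s b"
    let ?C = "C \<inter> Fix ?A"
    have AG: "?A \<subseteq> carrier G"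
      using level_subgroup_subset by blast
    have a: "a \<in> QS S"
      using insert.prems by simp
    have "?C \<inter> Fix (level_subgroup S s a) \<noteq> {}"
    proof (rule level_subgroup_fixed_point[OF s a])
      show "closedin X ?C"
        by (intro closedin_Int C(1) closedin_Fix AG)
      show "?C \<noteq> {}"
        using insert by simp
      fix k x assume k: "k \<in> level_subgroup S s a" and x: "x \<in> ?C"
      have kG: "k \<in> carrier G"
        using k level_subgroup_subset by blast
      have "\<phi> k x \<in> Fix ?A"
      proof (rule Fix_invariant[OF AG kG])
        fix f assume "f \<in> ?A"
        then obtain b where b: "b \<in> B" "b \<in> QS S" "f \<in> level_subgroup S s b"
          using insert.prems by blast
        have ib: "Aut_inv S k b \<in> QS S"
          using kG b(2) by (simp add: Aut_QS_mem)
        have "agree_above S s (k (Aut_inv S k b)) (Aut_inv S k b)"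
          using k ib by (auto simp: level_subgroup_def agree_above_def)
        then have "level_subgroup S s (Aut_inv S k b) = level_subgroup S s b"
          using kG b(2) by (intro level_subgroup_cong) (simp add: Aut_QS_apply_inv agree_above_sym)
        moreover have "Aut_inv S k \<otimes>\<^bsub>G\<^esub> (f \<otimes>\<^bsub>G\<^esub> k) \<in> level_subgroup S s (Aut_inv S k b)"
          using k by (intro level_subgroup_conj s b kG) (auto simp: level_subgroup_def)
        ultimately show "Aut_inv S k \<otimes>\<^bsub>G\<^esub> (f \<otimes>\<^bsub>G\<^esub> k) \<in> ?A"
          using b(1) by blast
      qed (use x in simp)
      moreover have "\<phi> k x \<in> C"
        using inv k a x by (auto simp: level_set_def)
      ultimately show "\<phi> k x \<in> ?C"
        by simp
    qed
    moreover have "Fix ?A \<inter> Fix (level_subgroup S s a) = Fix (\<Union>b\<in>insert a B. level_subgroup S s b)"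
      by (auto simp: Fix_def)
    ultimately show ?case
      by (simp add: Int_assoc)
  qed
qed

text \<open>Levels are added in increasing order. An element of level \<open>t\<close> changes no
  coordinate below \<open>t\<close>, so for \<open>s < t\<close> conjugation by it stays within
  \<open>level_set s\<close>, though possibly over another prefix. This is why all prefixes of a
  level are handled together before the next level.\<close>

lemma all_levels_fixed_point: "Fix (\<Union>s\<in>S. level_set s) \<noteq> {}"
proof -
  have "topspace X \<inter> Fix (\<Union>s\<in>S. level_set s) \<noteq> {}"
  proof (rule Fix_Union_nonempty[OF closedin_topspace level_set_subset])
    fix S' assume "finite S'" "S' \<subseteq> S"
    then have "Fix (\<Union>s\<in>S'. level_set s) \<noteq> {}"
    proof (induction S' rule: finite_linorder_max_induct)
      case empty
      then show ?case
        using nonempty by (simp add: Fix_def)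
    next
      case (insert t S')
      let ?A = "\<Union>s\<in>S'. level_set s"
      have AG: "?A \<subseteq> carrier G"
        using level_set_subset by blast
      have t: "t \<in> S"
        using insert.prems by simp
      have "Fix ?A \<inter> Fix (level_set t) \<noteq> {}"
      proof (rule level_set_fixed_point[OF t closedin_Fix[OF AG]])
        show "Fix ?A \<noteq> {}"
          using insert by simp
        fix k x assume k: "k \<in> level_set t" and x: "x \<in> Fix ?A"
        have kG: "k \<in> carrier G"
          using k level_set_subset by blast
        show "\<phi> k x \<in> Fix ?A"
        proof (rule Fix_invariant[OF AG kG x])
          fix f assume "f \<in> ?A"
          then obtain s b where s: "s \<in> S'" "s \<in> S" "s < t"
            and b: "b \<in> QS S" "f \<in> level_subgroup S s b"
            using insert by (auto simp: level_set_def)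
          have "Aut_inv S k \<otimes>\<^bsub>G\<^esub> (f \<otimes>\<^bsub>G\<^esub> k) \<in> level_subgroup S s (Aut_inv S k b)"
            using k s(3) by (intro level_subgroup_conj s(2) b kG) (auto simp: level_set_def level_subgroup_def)
          moreover have "Aut_inv S k b \<in> QS S"
            using kG b(1) by (simp add: Aut_QS_mem)
          ultimately show "Aut_inv S k \<otimes>\<^bsub>G\<^esub> (f \<otimes>\<^bsub>G\<^esub> k) \<in> ?A"
            using s(1) by (auto simp: level_set_def)
        qed
      qed
      moreover have "Fix ?A \<inter> Fix (level_set t) = Fix (\<Union>s\<in>insert t S'. level_set s)"
        by (auto simp: Fix_def)
      ultimately show ?case
        by simp
    qed
    then show "topspace X \<inter> Fix (\<Union>s\<in>S'. level_set s) \<noteq> {}"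
      by (auto simp: Fix_def)
  qed
  then show ?thesis
    by blast
qed

text \<open>The stabiliser of a point \<open>x\<close> fixed by all levels contains every level
  subgroup. If \<open>g\<close> moved \<open>x\<close>, some \<open>h\<close> in the stabiliser
  would agree with \<open>g\<close> on a finite set that forces \<open>\<phi> h x\<close> into an
  open set missing \<open>x\<close>.\<close>

lemma global_fixed_point: "\<exists>x\<in>topspace X. \<forall>g\<in>carrier G. \<phi> g x = x"
proof -
  obtain x where x: "x \<in> topspace X" "\<And>s g. s \<in> S \<Longrightarrow> g \<in> level_set s \<Longrightarrow> \<phi> g x = x"
    using all_levels_fixed_point by (auto simp: Fix_def)
  define H where "H = {g \<in> carrier G. \<phi> g x = x}"
  have "\<phi> g x = x" if g: "g \<in> carrier G" for g
  proof (rule ccontr)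
    assume "\<phi> g x \<noteq> x"
    then obtain U where U: "openin X U" "\<phi> g x \<in> U" "x \<notin> U"
      using Hausdorff act_mem[OF g x(1)] x(1) unfolding Hausdorff_space_def
      by (metis disjnt_iff)
    obtain F W where F: "finite F" "F \<subseteq> QS S" and "x \<in> W"
      and FW: "\<forall>h\<in>carrier G. (\<forall>z\<in>F. h z = g z) \<longrightarrow> (\<forall>y\<in>W. \<phi> h y \<in> U)"
      using act_continuous[OF g x(1) U(1,2)] by blast
    have "\<exists>h\<in>H. \<forall>z\<in>F. h z = g z"
    proof (rule level_subgroups_dense[OF _ _ _ _ F g])
      show "level_subgroup S s a \<subseteq> H" if "s \<in> S" "a \<in> QS S" for s a
        using x(2)[OF that(1)] that(2) level_subgroup_subset by (auto simp: H_def level_set_def)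
    qed (auto simp: H_def act_one act_mult x(1))
    then obtain h where "h \<in> carrier G" "\<phi> h x = x" "\<forall>z\<in>F. h z = g z"
      by (auto simp: H_def)
    then show False
      using FW \<open>x \<in> W\<close> U(3) by metis
  qed
  then show ?thesis
    using x(1) by blast
qed

end

theorem theorem10:
  fixes S :: "real set"
  assumes "S \<subseteq> {0<..}" and "countable S"
  shows "extremely_amenable TYPE('x) (Aut_QS_lex S) (pointwise_topology S)"
  unfolding extremely_amenable_def
  using topological_group_Aut_QS_lex Aut_QS_flow.global_fixed_point[OF Aut_QS_flow.intro] by blast

end
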